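(* Let $C\subseteq\mathbb{R}^n$ be a nonempty convex compact set, let $f:C\times C\to\mathbb{R}$ satisfy $f(x,x)=0$ for all $x\in C$, and let $K:C\rightrightarrows C$ be a set-valued map. Let $A\supseteq C$ be an open subset of $\operatorname{aff}C$ and let $\hat f:C\times A\to\mathbb{R}$ be a bifunction such that $\hat f(x,y)=f(x,y)$ for all $(x,y)\in C\times C$. Let $\hat F$ be the set-valued map defined on $C$ by $\hat F(x):=\{y\in A:\hat f(x,y)<0\}$. Assume that $K$ is lower semicontinuous with nonempty convex values and that $\operatorname{fix}K$ is closed. Moreover suppose that (i) $\hat F(x)$ is convex for every $x\in\operatorname{fix}K$; (ii) $\hat F$ has open lower sections on $\operatorname{fix}K$; (iii) $\hat F(x)$ is open in $\operatorname{aff}C$ for all $x\in\partial_C\operatorname{fix}K$. Then the quasiequilibrium problem has a solution, i.e. there exists $x\in C$ such that $x\in K(x)$ and $f(x,y)\ge 0$ for all $y\in K(x)$.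
   Context: A set-valued map $\Phi:X\rightrightarrows Y$ between topological spaces assigns to each $x\in X$ a (possibly empty) subset $\Phi(x)\subseteq Y$. It is lower semicontinuous at $x$ if for each open set $\Omega$ with $\Phi(x)\cap\Omega\neq\emptyset$ there is a neighborhood $U_x$ of $x$ such that $\Phi(x')\cap\Omega\neq\emptyset$ for all $x'\in U_x$; it is lower semicontinuous if it is so at every point. The lower section of $\Phi$ at $y\in Y$ is $\Phi^{-1}(y):=\{x\in X: y\in\Phi(x)\}$; "$\Phi$ has open lower sections on $S$", for $S\subseteq X$, means that $\Phi^{-1}(y)\cap S$ is open in the relative topology of $S$ for every $y\in Y$ (for $\hat F$, $Y=A$). $\operatorname{fix}K:=\{x\in C: x\in K(x)\}$. For $B\subseteq C$, $\operatorname{int}_CB$ and $\operatorname{cl}_CB$ are the interior and closure of $B$ in the relative topology of $C$, and $\partial_CB:=\operatorname{cl}_CB\setminus\operatorname{int}_CB$. $\operatorname{aff}C$ is the affine hull of $C$, the smallest affine subset of $\mathbb{R}^n$ containing $C$, with the relative topology. *)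

theory Defs
  imports "HOL-Analysis.Analysis"
begin

text \<open>A set-valued map is a total function into sets, of which only the values on its domain matter;
  these may be empty.\<close>

definition set_valued_map :: "'a set \<Rightarrow> 'b set \<Rightarrow> ('a \<Rightarrow> 'b set) \<Rightarrow> bool" where
  "set_valued_map S T \<Phi> \<longleftrightarrow> (\<forall>x\<in>S. \<Phi> x \<subseteq> T)"

definition lsc_at :: "'a topology \<Rightarrow> 'b topology \<Rightarrow> ('a \<Rightarrow> 'b set) \<Rightarrow> 'a \<Rightarrow> bool" where
  "lsc_at X Y \<Phi> x \<longleftrightarrow>
     (\<forall>\<Omega>. openin Y \<Omega> \<and> \<Phi> x \<inter> \<Omega> \<noteq> {} \<longrightarrow>
        (\<exists>U. openin X U \<and> x \<in> U \<and> (\<forall>x'\<in>U. \<Phi> x' \<inter> \<Omega> \<noteq> {})))"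

definition lsc_map :: "'a topology \<Rightarrow> 'b topology \<Rightarrow> ('a \<Rightarrow> 'b set) \<Rightarrow> bool" where
  "lsc_map X Y \<Phi> \<longleftrightarrow> (\<forall>x\<in>topspace X. lsc_at X Y \<Phi> x)"

definition lower_section :: "'a topology \<Rightarrow> ('a \<Rightarrow> 'b set) \<Rightarrow> 'b \<Rightarrow> 'a set" where
  "lower_section X \<Phi> y = {x \<in> topspace X. y \<in> \<Phi> x}"

definition open_lower_sections_on ::
    "'a topology \<Rightarrow> 'b set \<Rightarrow> ('a \<Rightarrow> 'b set) \<Rightarrow> 'a set \<Rightarrow> bool" where
  "open_lower_sections_on X T \<Phi> S \<longleftrightarrow>
     (\<forall>y\<in>T. openin (subtopology X S) (lower_section X \<Phi> y \<inter> S))"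

definition fix_points :: "'a set \<Rightarrow> ('a \<Rightarrow> 'a set) \<Rightarrow> 'a set" where
  "fix_points C K = {x \<in> C. x \<in> K x}"

definition neg_sublevel_map :: "'b set \<Rightarrow> ('a \<Rightarrow> 'b \<Rightarrow> real) \<Rightarrow> 'a \<Rightarrow> 'b set" where
  "neg_sublevel_map A g x = {y \<in> A. g x y < 0}"

end

theory Submission
  imports Defs
begin

text \<open>Suppose there is no solution, so \<open>K x\<close> meets \<open>Fhat x\<close> for every \<open>x\<close> in \<open>P = fix K\<close>. Modify \<open>K\<close> to
  \<open>G\<close> by putting \<open>G x = Fhat x \<inter> C\<close> on the relative interior of \<open>P\<close> in \<open>C\<close> and \<open>G x = K x \<inter> Fhat x\<close> on
  its relative boundary. Then \<open>G\<close> is lower semicontinuous: in the interior the open lower sections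
  suffice, because \<open>K\<close> has been dropped there, and at a boundary point \<open>Fhat x\<close> contains a polytope
  around any given point whose finitely many vertices, hence all of whose points, persist in the
  nearby values. By Michael's selection theorem for convex, not necessarily closed, values in finite
  dimension and Brouwer's theorem, \<open>G\<close> has a fixed point \<open>x\<close>; it must lie in \<open>P\<close>, so
  \<open>f x x < 0\<close>, a contradiction.\<close>

section \<open>Lower semicontinuity in metric form\<close>

text \<open>Balls suffice as test sets. The punctured filter loses nothing, since at
  \<open>x\<close> itself the point \<open>y\<close> is its own witness.\<close>

lemma lsc_map_top_of_set_iff:
  fixes H :: "'a::metric_space \<Rightarrow> 'b::metric_space set"
  shows "lsc_map (top_of_set X) euclidean H \<longleftrightarrow>
    (\<forall>x\<in>X. \<forall>y\<in>H x. \<forall>e>0. eventually (\<lambda>x'. \<exists>y'\<in>H x'. dist y y' < e) (at x within X))"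
    (is "?L \<longleftrightarrow> ?R")
proof
  assume L: ?L
  show ?R
  proof (intro ballI allI impI)
    fix x y and e :: real
    assume x: "x \<in> X" and y: "y \<in> H x" and e: "e > 0"
    have "lsc_at (top_of_set X) euclidean H x"
      using L x by (auto simp: lsc_map_def)
    moreover have "openin euclidean (ball y e)" "H x \<inter> ball y e \<noteq> {}"
      using y e by auto
    ultimately obtain U where U: "openin (top_of_set X) U" "x \<in> U"
      "\<And>x'. x' \<in> U \<Longrightarrow> H x' \<inter> ball y e \<noteq> {}"
      unfolding lsc_at_def by metis
    then obtain T where "open T" "U = X \<inter> T" by (auto simp: openin_open)
    with U show "eventually (\<lambda>x'. \<exists>y'\<in>H x'. dist y y' < e) (at x within X)"
      unfolding eventually_at_topological by (intro exI[of _ T]) fastforce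
  qed
next
  assume R: ?R
  show ?L
    unfolding lsc_map_def lsc_at_def topspace_euclidean_subtopology
  proof (intro ballI allI impI)
    fix x \<Omega> assume x: "x \<in> X" and "openin euclidean \<Omega> \<and> H x \<inter> \<Omega> \<noteq> {}"
    then obtain y where y: "open \<Omega>" "y \<in> H x" "y \<in> \<Omega>" by auto
    then obtain e where e: "e > 0" "ball y e \<subseteq> \<Omega>" by (meson open_contains_ball)
    from R x y e have "eventually (\<lambda>x'. \<exists>y'\<in>H x'. dist y y' < e) (at x within X)" by blast
    then obtain T where T: "open T" "x \<in> T"
      "\<And>x'. x' \<in> T \<Longrightarrow> x' \<noteq> x \<Longrightarrow> x' \<in> X \<Longrightarrow> \<exists>y'\<in>H x'. dist y y' < e"
      unfolding eventually_at_topological by blast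
    have "H x' \<inter> \<Omega> \<noteq> {}" if "x' \<in> X \<inter> T" for x'
    proof (cases "x' = x")
      case False
      with that have "\<exists>y'\<in>H x'. dist y y' < e" by (intro T(3)) auto
      with e show ?thesis by auto
    qed (use y in auto)
    then show "\<exists>U. openin (top_of_set X) U \<and> x \<in> U \<and> (\<forall>x'\<in>U. H x' \<inter> \<Omega> \<noteq> {})"
      using T x by (intro exI[of _ "X \<inter> T"]) auto
  qed
qed

lemma lsc_map_openin:
  assumes "lsc_map (top_of_set X) euclidean H" "open \<Omega>"
  shows "openin (top_of_set X) {x \<in> X. H x \<inter> \<Omega> \<noteq> {}}"
proof (subst openin_subopen, intro ballI)
  fix x assume "x \<in> {x \<in> X. H x \<inter> \<Omega> \<noteq> {}}"
  then have "lsc_at (top_of_set X) euclidean H x" "openin euclidean \<Omega> \<and> H x \<inter> \<Omega> \<noteq> {}"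
    using assms by (auto simp: lsc_map_def)
  then obtain U where "openin (top_of_set X) U" "x \<in> U" "\<forall>x'\<in>U. H x' \<inter> \<Omega> \<noteq> {}"
    unfolding lsc_at_def by blast
  then show "\<exists>T. openin (top_of_set X) T \<and> x \<in> T \<and> T \<subseteq> {x \<in> X. H x \<inter> \<Omega> \<noteq> {}}"
    using openin_imp_subset by (intro exI[of _ U]) fastforce
qed

text \<open>Openness of the ball leaves slack at \<open>y\<close>: half of it absorbs the motion of
  the centre \<open>h x\<close>, the other half the move from \<open>y\<close> to a point of the
  nearby value.\<close>

lemma lsc_map_Int_ball:
  fixes H :: "'a::metric_space \<Rightarrow> 'b::metric_space set"
  assumes H: "lsc_map (top_of_set X) euclidean H" and h: "continuous_on X h"
  shows "lsc_map (top_of_set X) euclidean (\<lambda>x. H x \<inter> ball (h x) r)"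
  unfolding lsc_map_top_of_set_iff
proof (intro ballI allI impI)
  fix x y and e :: real
  assume x: "x \<in> X" and y: "y \<in> H x \<inter> ball (h x) r" and e: "e > 0"
  define d where "d = (r - dist (h x) y) / 2"
  have d: "d > 0" using y by (simp add: d_def)
  have "eventually (\<lambda>x'. dist (h x') (h x) < d) (at x within X)"
    using h x d by (auto simp: continuous_on_def dest: tendstoD)
  moreover have "eventually (\<lambda>x'. \<exists>y'\<in>H x'. dist y y' < min d e) (at x within X)"
    using H[unfolded lsc_map_top_of_set_iff, rule_format, OF x, of y "min d e"] y d e by simp
  ultimately show "eventually (\<lambda>x'. \<exists>y'\<in>H x' \<inter> ball (h x') r. dist y y' < e) (at x within X)"
  proof eventually_elim
    case (elim x')
    then obtain y' where y': "y' \<in> H x'" "dist y y' < d" "dist y y' < e" by auto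
    have "dist (h x') y' \<le> dist (h x') (h x) + dist (h x) y + dist y y'"
      using dist_triangle[of "h x'" y' "h x"] dist_triangle[of "h x" y' y] by linarith
    also have "\<dots> < d + dist (h x) y + d" using elim y' by linarith
    also have "\<dots> = r" by (simp add: d_def field_simps)
    finally show ?case using y' by auto
  qed
qed

text \<open>Near a point outside \<open>Z\<close> only \<open>H\<close> is seen, because
  \<open>Z\<close> is closed. Near a point of \<open>Z\<close> the values are those of
  \<open>G\<close> or the larger ones of \<open>H\<close>, so approximating points of
  \<open>G\<close> remain available.\<close>

lemma lsc_map_if_closed:
  fixes H :: "'a::metric_space \<Rightarrow> 'b::metric_space set"
  assumes H: "lsc_map (top_of_set X) euclidean H" and G: "lsc_map (top_of_set X) euclidean G"
    and sub: "\<And>x. x \<in> X \<Longrightarrow> G x \<subseteq> H x" and Z: "closed Z"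
  shows "lsc_map (top_of_set X) euclidean (\<lambda>x. if x \<in> Z then G x else H x)"
  unfolding lsc_map_top_of_set_iff
proof (intro ballI allI impI)
  fix x y and e :: real
  assume x: "x \<in> X" and y: "y \<in> (if x \<in> Z then G x else H x)" and e: "e > 0"
  show "eventually (\<lambda>x'. \<exists>y'\<in>(if x' \<in> Z then G x' else H x'). dist y y' < e) (at x within X)"
  proof (cases "x \<in> Z")
    case True
    then have "eventually (\<lambda>x'. \<exists>y'\<in>G x'. dist y y' < e) (at x within X)"
      using G x y e unfolding lsc_map_top_of_set_iff by simp
    moreover have "eventually (\<lambda>x'. x' \<in> X) (at x within X)"
      by (simp add: eventually_at_topological) blast
    ultimately show ?thesis
      by eventually_elim (use sub in auto)
  next
    case False
    then have "eventually (\<lambda>x'. x' \<notin> Z) (at x within X)"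
      using Z unfolding eventually_at_topological by (intro exI[of _ "- Z"]) auto
    moreover have "eventually (\<lambda>x'. \<exists>y'\<in>H x'. dist y y' < e) (at x within X)"
      using H x y e False unfolding lsc_map_top_of_set_iff by simp
    ultimately show ?thesis
      by eventually_elim auto
  qed
qed

section \<open>Continuous selections of the closure\<close>

text \<open>A partition of unity averages finitely many centres. Those with nonzero weight at
  \<open>x\<close> lie within \<open>e\<close> of \<open>H x\<close>, and the
  \<open>e\<close>-neighbourhood of a convex set is convex.\<close>

lemma lsc_map_approximate_selection:
  fixes H :: "'a::metric_space \<Rightarrow> 'b::real_normed_vector set"
  assumes X: "compact X" and H: "lsc_map (top_of_set X) euclidean H"
    and ne: "\<And>x. x \<in> X \<Longrightarrow> H x \<noteq> {}" and conv: "\<And>x. x \<in> X \<Longrightarrow> convex (H x)"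
    and e: "e > 0"
  shows "\<exists>h. continuous_on X h \<and> (\<forall>x\<in>X. H x \<inter> ball (h x) e \<noteq> {})"
proof -
  have "\<exists>T. open T \<and> {x \<in> X. H x \<inter> ball y e \<noteq> {}} = X \<inter> T" for y
    using lsc_map_openin[OF H open_ball, of y e] by (auto simp: openin_open)
  then obtain T where T: "\<And>y. open (T y)" "\<And>y. {x \<in> X. H x \<inter> ball y e \<noteq> {}} = X \<inter> T y"
    by metis
  have "X \<subseteq> \<Union>(range T)"
  proof
    fix x assume "x \<in> X"
    moreover from this obtain y where "y \<in> H x" using ne by blast
    ultimately have "x \<in> {x \<in> X. H x \<inter> ball y e \<noteq> {}}" using e by auto
    then show "x \<in> \<Union>(range T)" using T(2) by blast
  qed
  then obtain \<C> where \<C>: "\<C> \<subseteq> range T" "finite \<C>" "X \<subseteq> \<Union>\<C>"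
    using compactE[OF X, of "range T"] T(1) by auto
  obtain p where p: "\<And>U. U \<in> \<C> \<Longrightarrow> U = T (p U)"
    using \<C>(1) by (metis f_inv_into_f subsetD)
  obtain F :: "'a set \<Rightarrow> 'a \<Rightarrow> real"
    where F: "\<And>U. U \<in> \<C> \<Longrightarrow> continuous_on X (F U) \<and> (\<forall>x \<in> X. 0 \<le> F U x)"
      "\<And>x U. \<lbrakk>U \<in> \<C>; x \<in> X; x \<notin> U\<rbrakk> \<Longrightarrow> F U x = 0"
      "\<And>x. x \<in> X \<Longrightarrow> supp_sum (\<lambda>W. F W x) \<C> = 1"
  proof (rule subordinate_partition_of_unity[of X \<C>])
    show "\<And>U. U \<in> \<C> \<Longrightarrow> open U" using \<C>(1) T(1) by auto
    show "\<exists>V. open V \<and> x \<in> V \<and> finite {U \<in> \<C>. U \<inter> V \<noteq> {}}" if "x \<in> X" for x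
      using \<C>(2) by (intro exI[of _ UNIV]) auto
  qed (use \<C> in auto)
  define h where "h x = (\<Sum>U\<in>\<C>. F U x *\<^sub>R p U)" for x
  have "continuous_on X h"
    unfolding h_def using F(1) by (intro continuous_intros) auto
  moreover have "H x \<inter> ball (h x) e \<noteq> {}" if x: "x \<in> X" for x
  proof -
    define S where "S = {U \<in> \<C>. F U x \<noteq> 0}"
    \<comment> \<open>The \<open>e\<close>-neighbourhood of \<open>H x\<close>, written as a
      Minkowski sum so that \<open>convex_sums\<close> applies.\<close>
    define M where "M = (\<Union>y\<in>H x. \<Union>z\<in>ball 0 e. {y + z})"
    have "h x = (\<Sum>U\<in>S. F U x *\<^sub>R p U)"
      unfolding h_def S_def by (intro sum.mono_neutral_right) (use \<C> in auto)
    also have "\<dots> \<in> M"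
    proof (rule convex_sum)
      show "finite S" using \<C> by (simp add: S_def)
      show "convex M" unfolding M_def using conv x by (intro convex_sums) auto
      show "(\<Sum>U\<in>S. F U x) = 1"
        using F(3)[OF x] by (simp add: supp_sum_def support_on_def S_def)
      show "0 \<le> F U x" if "U \<in> S" for U using F(1) that x by (auto simp: S_def)
      show "p U \<in> M" if "U \<in> S" for U
      proof -
        have U: "U \<in> \<C>" "x \<in> U" using that F(2) x by (auto simp: S_def)
        then have "x \<in> X \<inter> T (p U)" using p x by auto
        then obtain y where "y \<in> H x" "dist (p U) y < e"
          unfolding T(2)[symmetric] by auto
        then show ?thesis unfolding M_def
          by (intro UN_I[of y] UN_I[of "p U - y"]) (auto simp: dist_norm norm_minus_commute)
      qed
    qed
    finally obtain y z where "y \<in> H x" "norm z < e" "h x = y + z"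
      by (auto simp: M_def)
    then show ?thesis by (auto simp: dist_norm intro!: exI[of _ y])
  qed
  ultimately show ?thesis by blast
qed

text \<open>Approximate selections are refined successively. Errors halve and consecutive maps stay
  geometrically close, so they converge uniformly; the limit is only guaranteed to lie in the
  closure of the values.\<close>

proposition lsc_map_closure_selection:
  fixes H :: "'a::metric_space \<Rightarrow> 'b::banach set"
  assumes X: "compact X" and H: "lsc_map (top_of_set X) euclidean H"
    and ne: "\<And>x. x \<in> X \<Longrightarrow> H x \<noteq> {}" and conv: "\<And>x. x \<in> X \<Longrightarrow> convex (H x)"
  shows "\<exists>g. continuous_on X g \<and> (\<forall>x\<in>X. g x \<in> closure (H x))"
proof -
  let ?P = "\<lambda>n h. continuous_on X h \<and> (\<forall>x\<in>X. H x \<inter> ball (h x) ((1/2)^n) \<noteq> {})"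
  let ?Q = "\<lambda>n h h'. \<forall>x\<in>X. dist (h x) (h' x) < 2 * (1/2)^n"
  have "\<exists>h. \<forall>n. ?P n (h n) \<and> ?Q n (h n) (h (Suc n))"
  proof (rule dependent_nat_choice)
    show "\<exists>h. ?P 0 h"
      using lsc_map_approximate_selection[OF X H ne conv, of "1"] by simp
    fix h n assume h: "?P n h"
    \<comment> \<open>Approximating this smaller map, rather than \<open>H\<close>, keeps the next
      approximation close to \<open>h\<close>.\<close>
    let ?H = "\<lambda>x. H x \<inter> ball (h x) ((1/2)^n)"
    have "\<exists>h'. continuous_on X h' \<and> (\<forall>x\<in>X. ?H x \<inter> ball (h' x) ((1/2)^Suc n) \<noteq> {})"
      using h conv
      by (intro lsc_map_approximate_selection X lsc_map_Int_ball[OF H]) (auto intro!: convex_Int)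
    then obtain h' where h': "continuous_on X h'"
      "\<And>x. x \<in> X \<Longrightarrow> ?H x \<inter> ball (h' x) ((1/2)^Suc n) \<noteq> {}" by blast
    have "dist (h x) (h' x) < 2 * (1/2)^n" if x: "x \<in> X" for x
    proof -
      obtain y where "y \<in> ?H x \<inter> ball (h' x) ((1/2)^Suc n)"
        using h'(2)[OF x] by blast
      then have y: "dist (h x) y < (1/2)^n" "dist (h' x) y < (1/2)^Suc n"
        by auto
      have "(1/2::real)^Suc n \<le> (1/2)^n" by simp
      with y show ?thesis using dist_triangle2[of "h x" "h' x" y] by linarith
    qed
    with h' show "\<exists>h'. ?P (Suc n) h' \<and> ?Q n h h'" by blast
  qed
  then obtain h where P: "\<And>n. ?P n (h n)" and Q: "\<And>n. ?Q n (h n) (h (Suc n))"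
    by blast
  \<comment> \<open>The limit is written as a telescoping series, to which the Weierstrass test
    applies.\<close>
  define D where "D n x = h (Suc n) x - h n x" for n x
  define g where "g x = h 0 x + (\<Sum>n. D n x)" for x
  have "uniform_limit X (\<lambda>n x. \<Sum>i<n. D i x) (\<lambda>x. \<Sum>i. D i x) sequentially"
  proof (rule Weierstrass_m_test)
    show "norm (D n x) \<le> 2 * (1/2)^n" if "x \<in> X" for n x
      using Q[of n] that by (auto simp: D_def dist_norm norm_minus_commute intro: less_imp_le)
    show "summable (\<lambda>n. 2 * (1/2::real)^n)"
      by (intro summable_mult summable_geometric) auto
  qed
  then have "uniform_limit X (\<lambda>n x. h 0 x + (\<Sum>i<n. D i x)) g sequentially"
    unfolding g_def by (intro uniform_limit_add uniform_limit_const)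
  moreover have "h 0 x + (\<Sum>i<n. D i x) = h n x" for n x
    unfolding D_def by (subst sum_lessThan_telescope) simp
  ultimately have lim: "uniform_limit X h g sequentially"
    by simp
  then have "continuous_on X g"
    by (rule uniform_limit_theorem[rotated]) (use P in auto)
  moreover have "g x \<in> closure (H x)" if x: "x \<in> X" for x
  proof -
    have "\<exists>y. y \<in> H x \<and> dist (h n x) y < (1/2)^n" for n
      using P[of n] x by auto
    then obtain y where y: "\<And>n. y n \<in> H x" "\<And>n. dist (h n x) (y n) < (1/2)^n" by metis
    have "(\<lambda>n. y n - h n x) \<longlonglongrightarrow> 0"
    proof (rule Lim_null_comparison)
      show "(\<lambda>n. (1/2::real)^n) \<longlonglongrightarrow> 0" by (intro LIMSEQ_power_zero) auto
      show "eventually (\<lambda>n. norm (y n - h n x) \<le> (1/2)^n) sequentially"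
        using y(2) by (intro always_eventually) (auto simp: dist_norm norm_minus_commute intro: less_imp_le)
    qed
    moreover have "(\<lambda>n. h n x) \<longlonglongrightarrow> g x"
      using lim x by (rule tendsto_uniform_limitI)
    ultimately have "y \<longlonglongrightarrow> g x"
      using tendsto_add[of "\<lambda>n. y n - h n x" 0 sequentially "\<lambda>n. h n x" "g x"] by simp
    then show ?thesis using y(1) closure_sequential by blast
  qed
  ultimately show ?thesis by blast
qed

section \<open>Selections for convex values that need not be closed\<close>

text \<open>Otherwise a hyperplane supports \<open>S\<close> at \<open>z\<close>. All weights are
  positive, so averaging to \<open>z\<close> forces every \<open>g n\<close> into that hyperplane;
  by density \<open>S\<close> lies in it too, although points of the relative interior are strictly
  on one side.\<close>

lemma infinite_convex_combination_in_rel_interior: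
  fixes S :: "'a::euclidean_space set" and g :: "nat \<Rightarrow> 'a"
  assumes S: "convex S" "S \<noteq> {}" and g: "range g \<subseteq> closure S" "S \<subseteq> closure (range g)"
    and c: "\<And>n. c n > 0" "c sums 1" and z: "(\<lambda>n. c n *\<^sub>R g n) sums z"
  shows "z \<in> rel_interior S"
proof (rule ccontr)
  assume nz: "z \<notin> rel_interior S"
  \<comment> \<open>As the weights sum to 1, affine functionals commute with the infinite convex
    combination.\<close>
  have sums: "(\<lambda>n. c n * (a \<bullet> g n - b)) sums (a \<bullet> z - b)" for a b
  proof -
    have "(\<lambda>n. a \<bullet> (c n *\<^sub>R g n) - c n * b) sums (a \<bullet> z - 1 * b)"
      by (intro sums_diff sums_mult2 c bounded_linear.sums[OF bounded_linear_inner_right z])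
    then show ?thesis by (simp add: algebra_simps)
  qed
  have zc: "z \<in> closure S"
  proof (rule ccontr)
    assume "z \<notin> closure S"
    then obtain a b where ab: "a \<bullet> z < b" "\<And>y. y \<in> closure S \<Longrightarrow> a \<bullet> y > b"
      using separating_hyperplane_closed_point[of "closure S" z] S by (auto intro: convex_closure)
    have "0 \<le> c n * (a \<bullet> g n - b)" for n
      using c(1)[of n] ab(2)[of "g n"] g(1) by (simp add: image_subset_iff)
    then have "0 \<le> a \<bullet> z - b"
      using sums[of a b] suminf_nonneg by (fastforce simp: sums_iff)
    with ab(1) show False by simp
  qed
  obtain a where a: "\<And>y. y \<in> closure S \<Longrightarrow> a \<bullet> z \<le> a \<bullet> y"
    "\<And>y. y \<in> rel_interior S \<Longrightarrow> a \<bullet> z < a \<bullet> y"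
    using supporting_hyperplane_relative_frontier[OF S(1) zc nz] by metis
  have "0 \<le> c n * (a \<bullet> g n - a \<bullet> z)" for n
    using c(1)[of n] a(1)[of "g n"] g(1) by (simp add: image_subset_iff)
  then have "\<forall>n. c n * (a \<bullet> g n - a \<bullet> z) = 0"
    using sums[of a "a \<bullet> z"] by (subst suminf_eq_zero_iff[symmetric]) (auto simp: sums_iff)
  then have "a \<bullet> g n = a \<bullet> z" for n using c(1)[of n] by (auto simp: less_le)
  then have "closure (range g) \<subseteq> {y. a \<bullet> y = a \<bullet> z}"
    by (intro closure_minimal closed_hyperplane) auto
  moreover obtain y where "y \<in> rel_interior S"
    using S rel_interior_eq_empty by blast
  ultimately show False
    using a(2)[of y] g(2) rel_interior_subset by fastforce
qed

text \<open>A weighted sum of a dense sequence of selections of the closure of \<open>H\<close> lies in the relative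
  interior of \<open>H x\<close>, hence in \<open>H x\<close> itself.\<close>

theorem lsc_map_selection:
  fixes H :: "'a::metric_space \<Rightarrow> 'b::euclidean_space set"
  assumes X: "compact X" and H: "lsc_map (top_of_set X) euclidean H"
    and ne: "\<And>x. x \<in> X \<Longrightarrow> H x \<noteq> {}" and conv: "\<And>x. x \<in> X \<Longrightarrow> convex (H x)"
    and bdd: "bounded B" "\<And>x. x \<in> X \<Longrightarrow> H x \<subseteq> B"
  shows "\<exists>g. continuous_on X g \<and> (\<forall>x\<in>X. g x \<in> H x)"
proof -
  obtain Q :: "'b set" where Q: "countable Q" "\<And>U. open U \<Longrightarrow> U \<noteq> {} \<Longrightarrow> \<exists>q\<in>Q. q \<in> U"
    using countable_dense_exists by metis
  obtain q :: "nat \<Rightarrow> 'b" where q: "range q = Q"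
    using Q range_from_nat_into[of Q] by (metis UNIV_not_empty empty_iff open_UNIV)
  define Y where "Y i m = {x \<in> X. H x \<inter> ball (q i) (1 / real (Suc m)) \<noteq> {}}" for i m
  have "\<exists>T. open T \<and> Y i m = X \<inter> T" for i m
    using lsc_map_openin[OF H open_ball] unfolding Y_def by (auto simp: openin_open)
  then obtain T where T: "\<And>i m. open (T i m)" "\<And>i m. Y i m = X \<inter> T i m" by metis
  \<comment> \<open>\<open>Y i m\<close> is the union over \<open>k\<close> of its parts in the closed sets \<open>Z i m k\<close>, and on each of
    these \<open>H\<close> may be shrunk without losing lower semicontinuity.\<close>
  define Z where "Z i m k = {x. ball x (1 / real (Suc k)) \<subseteq> T i m}" for i m k
  have Z: "closed (Z i m k)" for i m k
  proof -
    \<comment> \<open>A ball of this radius lies in \<open>T i m\<close> exactly when every point of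
      the complement is at least the radius away, which exhibits an intersection of closed
      sets.\<close>
    have "Z i m k = (\<Inter>y\<in>- T i m. {x. 1 / real (Suc k) \<le> dist x y})"
      unfolding Z_def subset_iff mem_ball not_le[symmetric] by blast
    also have "closed \<dots>"
      by (intro closed_INT ballI closed_Collect_le continuous_intros)
    finally show ?thesis .
  qed
  \<comment> \<open>Over \<open>Z i m k\<close> a selection of the closure is forced near
    \<open>q i\<close>; elsewhere it is only tied to \<open>H\<close>.\<close>
  define G where "G i m k x =
    (if x \<in> Z i m k then H x \<inter> ball (q i) (1 / real (Suc m)) else H x)" for i m k x
  have "\<exists>g. continuous_on X g \<and> (\<forall>x\<in>X. g x \<in> closure (G i m k x))" for i m k
  proof (rule lsc_map_closure_selection[OF X])
    show "lsc_map (top_of_set X) euclidean (G i m k)"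
      unfolding G_def
      by (intro lsc_map_if_closed H Z lsc_map_Int_ball continuous_on_const) auto
    fix x assume x: "x \<in> X"
    show "convex (G i m k x)"
      using conv x by (auto simp: G_def intro!: convex_Int)
    have "x \<in> Y i m" if "x \<in> Z i m k"
      using that x unfolding T(2) Z_def by (auto dest: subsetD[of _ _ x])
    then show "G i m k x \<noteq> {}"
      using ne x by (auto simp: G_def Y_def)
  qed
  then obtain s where s: "\<And>i m k. continuous_on X (s i m k)"
    "\<And>i m k x. x \<in> X \<Longrightarrow> s i m k x \<in> closure (G i m k x)" by metis
  \<comment> \<open>The triples \<open>(i, m, k)\<close> are enumerated by a single natural
    number.\<close>
  define g where "g n = (case prod_decode n of (i, j) \<Rightarrow> case prod_decode j of (m, k) \<Rightarrow> s i m k)" for n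
  have g_eq: "g (prod_encode (i, prod_encode (m, k))) = s i m k" for i m k
    by (simp add: g_def)
  have g_cont: "continuous_on X (g n)" for n
    using s(1) by (simp add: g_def split: prod.split)
  have g_in: "g n x \<in> closure (H x)" if "x \<in> X" for n x
  proof -
    have "closure (G i m k x) \<subseteq> closure (H x)" for i m k
      by (intro closure_mono) (auto simp: G_def)
    then have "s i m k x \<in> closure (H x)" for i m k using s(2)[OF that] by blast
    then show ?thesis by (simp add: g_def split: prod.split)
  qed
  \<comment> \<open>Given \<open>y\<close> and \<open>e\<close>, choose \<open>m\<close> for the
    precision, then \<open>q i\<close> close to \<open>y\<close>, then \<open>k\<close> large enough
    that \<open>x\<close> lies in \<open>Z i m k\<close>; the selection \<open>s i m k\<close> then
    passes near \<open>y\<close>.\<close>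
  have dense: "H x \<subseteq> closure (range (\<lambda>n. g n x))" if x: "x \<in> X" for x
  proof (intro subsetI, subst closure_approachable, intro allI impI)
    fix y and e :: real assume y: "y \<in> H x" and e: "e > 0"
    obtain m where m: "1 / real (Suc m) < e / 2"
      using nat_approx_posE[of "e / 2"] e by auto
    obtain i where i: "dist y (q i) < 1 / real (Suc m)"
      using Q(2)[of "ball y (1 / real (Suc m))"] q by auto
    have "y \<in> H x \<inter> ball (q i) (1 / real (Suc m))" using y i by (simp add: dist_commute)
    then have "x \<in> Y i m" using x unfolding Y_def by blast
    then have "x \<in> T i m" using T(2) by blast
    then obtain d where d: "d > 0" "ball x d \<subseteq> T i m" using T(1) open_contains_ball by metis
    obtain k where k: "1 / real (Suc k) < d" using nat_approx_posE[OF d(1)] by auto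
    have "x \<in> Z i m k" unfolding Z_def using d k by fastforce
    then have "s i m k x \<in> closure (H x \<inter> ball (q i) (1 / real (Suc m)))"
      using s(2)[OF x, of i m k] by (simp add: G_def)
    also have "\<dots> \<subseteq> cball (q i) (1 / real (Suc m))"
      by (intro closure_minimal) auto
    finally have "dist (s i m k x) y < e"
      using i m dist_triangle2[of "s i m k x" y "q i"] by (simp add: dist_commute)
    then show "\<exists>z\<in>range (\<lambda>n. g n x). dist z y < e"
      unfolding g_eq[symmetric] by blast
  qed
  define c where "c n = (1/2::real)^Suc n" for n
  have c: "c n > 0" "c sums 1" for n
    unfolding c_def using power_half_series by auto
  \<comment> \<open>The closure of \<open>B\<close> is used because \<open>g n x\<close> is only
    known to lie in the closure of \<open>H x\<close>. The bound is uniform in \<open>x\<close>, as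
    the Weierstrass test requires.\<close>
  obtain b where b: "\<And>y. y \<in> closure B \<Longrightarrow> norm y \<le> b"
    using bounded_closure[OF bdd(1)] by (auto simp: bounded_iff)
  have bound: "norm (c n *\<^sub>R g n x) \<le> c n * b" if "x \<in> X" for n x
    using b[of "g n x"] g_in[OF that, of n] closure_mono[OF bdd(2)[OF that]] c(1)[of n]
    by (auto simp: mult_left_mono)
  have summable: "summable (\<lambda>n. c n * b)"
    using c(2) by (intro summable_mult2) (simp add: sums_iff)
  define h where "h x = (\<Sum>n. c n *\<^sub>R g n x)" for x
  have "uniform_limit X (\<lambda>n x. \<Sum>i<n. c i *\<^sub>R g i x) h sequentially"
    unfolding h_def by (rule Weierstrass_m_test[OF bound summable])
  then have "continuous_on X h"
    by (rule uniform_limit_theorem[rotated]) (auto intro!: always_eventually continuous_intros g_cont)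
  moreover have "h x \<in> H x" if x: "x \<in> X" for x
  proof -
    have "(\<lambda>n. c n *\<^sub>R g n x) sums h x"
      unfolding h_def by (intro summable_sums summable_comparison_test'[OF summable] bound x)
    moreover have "range (\<lambda>n. g n x) \<subseteq> closure (H x)" using g_in[OF x] by blast
    ultimately have "h x \<in> rel_interior (H x)"
      using infinite_convex_combination_in_rel_interior[OF conv[OF x] ne[OF x] _ dense[OF x] c]
      by blast
    then show ?thesis using rel_interior_subset by blast
  qed
  ultimately show ?thesis by blast
qed

text \<open>Brouwer's theorem applies to a continuous selection, which maps \<open>C\<close> into
  itself.\<close>

corollary lsc_map_fixed_point:
  fixes C :: "'a::euclidean_space set"
  assumes C: "compact C" "convex C" "C \<noteq> {}"
    and H: "lsc_map (top_of_set C) euclidean H"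
    and ne: "\<And>x. x \<in> C \<Longrightarrow> H x \<noteq> {}" and conv: "\<And>x. x \<in> C \<Longrightarrow> convex (H x)"
    and sub: "\<And>x. x \<in> C \<Longrightarrow> H x \<subseteq> C"
  shows "\<exists>x\<in>C. x \<in> H x"
proof -
  obtain g where g: "continuous_on C g" "\<And>x. x \<in> C \<Longrightarrow> g x \<in> H x"
    using lsc_map_selection[OF C(1) H ne conv compact_imp_bounded[OF C(1)] sub] by blast
  then have "g \<in> C \<rightarrow> C" using sub by blast
  then obtain x where "x \<in> C" "g x = x" using brouwer[OF C g(1)] by blast
  then show ?thesis using g(2) by metis
qed

section \<open>Polytope neighbourhoods and the quasiequilibrium problem\<close>

text \<open>Open lower sections control one point at a time; finitely many vertices transfer that
  control to a whole neighbourhood. The polytope is a small box around \<open>y\<close> cut with the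
  affine hull.\<close>

lemma openin_affine_hull_contains_polytope_neighbourhood:
  fixes C :: "'a::euclidean_space set"
  assumes U: "openin (top_of_set (affine hull C)) U" "y \<in> U"
  obtains S e where "finite S" "S \<subseteq> U" "e > 0" "ball y e \<inter> affine hull C \<subseteq> convex hull S"
proof -
  obtain d where d: "d > 0" "cball y d \<inter> affine hull C \<subseteq> U"
    using U by (meson openin_contains_cball)
  obtain a b where ab: "cbox a b \<subseteq> ball y d" "y \<in> box a b"
    using open_contains_cbox[OF open_ball, of y y d] d(1) by (metis centre_in_ball)
  have "polytope (cbox a b \<inter> affine hull C)"
    unfolding polytope_eq_bounded_polyhedron
    by (intro conjI polyhedron_Int polyhedron_interval polyhedron_affine_hull bounded_Int) auto
  then obtain S where S: "finite S" "cbox a b \<inter> affine hull C = convex hull S"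
    unfolding polytope_def by blast
  obtain e where e: "e > 0" "ball y e \<subseteq> box a b"
    using ab(2) open_box open_contains_ball by metis
  have "S \<subseteq> cbox a b \<inter> affine hull C"
    unfolding S(2) by (rule hull_subset)
  also have "\<dots> \<subseteq> cball y d \<inter> affine hull C"
    using ab(1) ball_subset_cball[of y d] by blast
  finally have "S \<subseteq> U" using d(2) by (rule subset_trans)
  moreover have "ball y e \<inter> affine hull C \<subseteq> cbox a b \<inter> affine hull C"
    using subset_trans[OF e(2) box_subset_cbox] by (rule Int_mono) simp
  then have "ball y e \<inter> affine hull C \<subseteq> convex hull S"
    unfolding S(2) .
  ultimately show ?thesis using that S(1) e(1) by blast
qed

theorem theorem3p2:
  fixes C A :: "(real ^ 'n) set"
    and f fhat :: "real ^ 'n \<Rightarrow> real ^ 'n \<Rightarrow> real"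
    and K Fhat :: "real ^ 'n \<Rightarrow> (real ^ 'n) set"
  defines "Fhat \<equiv> neg_sublevel_map A fhat"
  assumes "C \<noteq> {}" and "convex C" and "compact C"
    and "\<And>x. x \<in> C \<Longrightarrow> f x x = 0"
    and "set_valued_map C C K"
    and "C \<subseteq> A" and "openin (top_of_set (affine hull C)) A"
    and "\<And>x y. x \<in> C \<Longrightarrow> y \<in> C \<Longrightarrow> fhat x y = f x y"
    and "lsc_map (top_of_set C) (top_of_set C) K"
    and "\<And>x. x \<in> C \<Longrightarrow> K x \<noteq> {}"
    and "\<And>x. x \<in> C \<Longrightarrow> convex (K x)"
    and "closed (fix_points C K)"
    and "\<And>x. x \<in> fix_points C K \<Longrightarrow> convex (Fhat x)"
    and "open_lower_sections_on (top_of_set C) A Fhat (fix_points C K)"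
    and "\<And>x. x \<in> top_of_set C frontier_of (fix_points C K) \<Longrightarrow>
           openin (top_of_set (affine hull C)) (Fhat x)"
  shows "\<exists>x\<in>C. x \<in> K x \<and> (\<forall>y\<in>K x. f x y \<ge> 0)"
proof (rule ccontr)
  assume no_solution: "\<not> (\<exists>x\<in>C. x \<in> K x \<and> (\<forall>y\<in>K x. f x y \<ge> 0))"
  define P where "P = fix_points C K"
  define I where "I = top_of_set C interior_of P"
  have P: "P \<subseteq> C" "closed P" "I \<subseteq> P"
    using assms(13) by (simp_all add: P_def I_def interior_of_subset) (simp add: fix_points_def)
  have KC: "K x \<subseteq> C" if "x \<in> C" for x
    using assms(6) that by (auto simp: set_valued_map_def)
  have Fhat_A: "Fhat x \<subseteq> A" for x
    by (auto simp: Fhat_def neg_sublevel_map_def)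
  have KF: "K x \<inter> Fhat x \<noteq> {}" if x: "x \<in> P" for x
  proof -
    obtain y where "y \<in> K x" "f x y < 0"
      using no_solution x by (force simp: P_def fix_points_def not_le)
    moreover have "x \<in> C" "y \<in> C" using x P(1) KC \<open>y \<in> K x\<close> by blast+
    ultimately show ?thesis
      using assms(7) assms(9)[of x y] by (auto simp: Fhat_def neg_sublevel_map_def)
  qed
  \<comment> \<open>Since \<open>K\<close> takes values in \<open>C\<close>, an ambient open set may
    be replaced by its trace on \<open>C\<close>.\<close>
  have K_lsc: "lsc_map (top_of_set C) euclidean K"
    unfolding lsc_map_def lsc_at_def topspace_euclidean_subtopology
  proof (intro ballI allI impI)
    fix x \<Omega> assume x: "x \<in> C" and \<Omega>: "openin euclidean \<Omega> \<and> K x \<inter> \<Omega> \<noteq> {}"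
    have "openin (top_of_set C) (C \<inter> \<Omega>)" "K x \<inter> (C \<inter> \<Omega>) \<noteq> {}"
      using \<Omega> KC[OF x] by auto
    moreover have "lsc_at (top_of_set C) (top_of_set C) K x"
      using assms(10) x by (simp add: lsc_map_def)
    ultimately obtain U where "openin (top_of_set C) U" "x \<in> U"
      "\<forall>x'\<in>U. K x' \<inter> (C \<inter> \<Omega>) \<noteq> {}"
      unfolding lsc_at_def by metis
    then show "\<exists>U. openin (top_of_set C) U \<and> x \<in> U \<and> (\<forall>x'\<in>U. K x' \<inter> \<Omega> \<noteq> {})"
      by blast
  qed
  \<comment> \<open>Lower sections are open relative to \<open>P\<close> only, hence the implication
    inside the filter.\<close>
  have near_Fhat: "eventually (\<lambda>x'. x' \<in> P \<longrightarrow> y \<in> Fhat x') (at x within C)"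
    if x: "x \<in> P" and y: "y \<in> Fhat x" for x y
  proof -
    have "openin (top_of_set P) ({x \<in> C. y \<in> Fhat x} \<inter> P)"
      using assms(15) Fhat_A y P(1)
      by (auto simp: open_lower_sections_on_def lower_section_def P_def[symmetric]
          subtopology_subtopology Int_absorb1)
    then obtain T where "open T" "{x \<in> C. y \<in> Fhat x} \<inter> P = P \<inter> T"
      by (auto simp: openin_open)
    then show ?thesis
      unfolding eventually_at_topological using x y P(1) by (intro exI[of _ T]) blast
  qed
  \<comment> \<open>Off \<open>P\<close> the map remains \<open>K\<close>, which has no fixed points
    there. On \<open>I\<close> the intersection with \<open>C\<close> keeps \<open>G\<close> a map
    into \<open>C\<close>.\<close>
  define G where "G x = (if x \<notin> P then K x else if x \<in> I then Fhat x \<inter> C else K x \<inter> Fhat x)" for x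
  have "\<exists>x\<in>C. x \<in> G x"
  proof (rule lsc_map_fixed_point)
    fix x assume x: "x \<in> C"
    have "Fhat x \<inter> C \<noteq> {}" if "x \<in> P" using KF[OF that] KC[OF x] by blast
    then show "G x \<noteq> {}" using KF[of x] assms(11)[OF x] by (simp add: G_def)
    show "convex (G x)"
      using assms(3,12,14) x by (auto simp: G_def P_def intro!: convex_Int)
    show "G x \<subseteq> C" using KC x by (auto simp: G_def)
  next
    show "lsc_map (top_of_set C) euclidean G"
      unfolding lsc_map_top_of_set_iff
    proof (intro ballI allI impI)
      fix x y and e :: real
      assume x: "x \<in> C" and y: "y \<in> G x" and e: "e > 0"
      have in_C: "eventually (\<lambda>x'. x' \<in> C) (at x within C)"
        by (auto simp: eventually_at_topological)
      have K_near: "eventually (\<lambda>x'. \<exists>y'\<in>K x'. dist y y' < r) (at x within C)"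
        if "y \<in> K x" "r > 0" for r
        using K_lsc x that unfolding lsc_map_top_of_set_iff by blast
      consider "x \<notin> P" | "x \<in> I" | "x \<in> P" "x \<notin> I" by blast
      then show "eventually (\<lambda>x'. \<exists>y'\<in>G x'. dist y y' < e) (at x within C)"
      proof cases
        case 1
        then have "eventually (\<lambda>x'. x' \<notin> P) (at x within C)"
          using P(2) unfolding eventually_at_topological by (intro exI[of _ "- P"]) auto
        moreover have "eventually (\<lambda>x'. \<exists>y'\<in>K x'. dist y y' < e) (at x within C)"
          using 1 y e by (intro K_near) (auto simp: G_def)
        ultimately show ?thesis by eventually_elim (simp add: G_def)
      next
        case 2
        \<comment> \<open>All nearby points of \<open>C\<close> lie in \<open>I\<close>, so
          \<open>y\<close> itself persists as a value.\<close>
        then have "y \<in> Fhat x" "y \<in> C" "x \<in> P" using y P by (auto simp: G_def)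
        have "openin (top_of_set C) I" by (simp add: I_def)
        then obtain T where "open T" "I = C \<inter> T" by (auto simp: openin_open)
        then have "eventually (\<lambda>x'. x' \<in> I) (at x within C)"
          using 2 unfolding eventually_at_topological by (intro exI[of _ T]) auto
        with near_Fhat[OF \<open>x \<in> P\<close> \<open>y \<in> Fhat x\<close>] show ?thesis
          by eventually_elim (use P e \<open>y \<in> C\<close> in \<open>auto simp: G_def intro!: bexI[of _ y]\<close>)
      next
        case 3
        then have y: "y \<in> K x" "y \<in> Fhat x" using y by (auto simp: G_def)
        \<comment> \<open>This places \<open>x\<close> in the relative frontier of \<open>P\<close>,
          where the values of \<open>Fhat\<close> are open.\<close>
        have "P \<subseteq> top_of_set C closure_of P"
          using P(1) by (intro closure_of_subset) auto
        then have "openin (top_of_set (affine hull C)) (Fhat x)"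
          using assms(16) 3 by (auto simp: frontier_of_def P_def I_def)
        then obtain S r where S: "finite S" "S \<subseteq> Fhat x" "r > 0"
          "ball y r \<inter> affine hull C \<subseteq> convex hull S"
          using openin_affine_hull_contains_polytope_neighbourhood y(2) by metis
        have "eventually (\<lambda>x'. \<forall>z\<in>S. x' \<in> P \<longrightarrow> z \<in> Fhat x') (at x within C)"
          using near_Fhat[OF 3(1)] S(1,2) by (intro eventually_ball_finite) auto
        \<comment> \<open>Nearby points may lie off \<open>P\<close>, in \<open>I\<close> or on the
          boundary. One \<open>y'\<close> serves all three: it lies in \<open>K x'\<close> and in
          \<open>C\<close>, and radius \<open>r\<close> puts it in the hull of \<open>S\<close>,
          hence in \<open>Fhat x'\<close> when \<open>x'\<close> is in \<open>P\<close>.\<close>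
        moreover have "eventually (\<lambda>x'. \<exists>y'\<in>K x'. dist y y' < min r e) (at x within C)"
          using y S(3) e by (intro K_near) auto
        ultimately show ?thesis using near_Fhat[OF 3(1) y(2)] in_C
        proof eventually_elim
          case (elim x')
          then obtain y' where y': "y' \<in> K x'" "dist y y' < r" "dist y y' < e" by auto
          have "y' \<in> C" using y' KC elim by blast
          show ?case
          proof (cases "x' \<in> P")
            case True
            then have "convex hull S \<subseteq> Fhat x'"
              using elim assms(14) by (intro hull_minimal) (auto simp: P_def)
            moreover have "y' \<in> convex hull S"
              using S(4) y' \<open>y' \<in> C\<close> hull_subset[of C affine] by auto
            ultimately show ?thesis
              using y' \<open>y' \<in> C\<close> by (auto simp: G_def intro!: bexI[of _ y'])
          qed (use y' in \<open>auto simp: G_def\<close>)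
        qed
      qed
    qed
  qed (use assms in auto)
  then obtain x where x: "x \<in> C" "x \<in> G x" by blast
  \<comment> \<open>Off \<open>P\<close>, membership in \<open>G x\<close> would mean
    \<open>x\<close> is in \<open>K x\<close>, putting \<open>x\<close> in \<open>P\<close> after
    all.\<close>
  have "x \<in> P" using x by (auto simp: G_def P_def fix_points_def split: if_splits)
  with x have "fhat x x < 0"
    by (auto simp: G_def Fhat_def neg_sublevel_map_def split: if_splits)
  with x(1) assms(5,9) show False by simp
qed

end
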